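(* Let $G:\mathbb{H}\to\mathbb{R}$ be locally Lipschitz smooth and $\mu$-strongly convex (both with respect to the $\mathcal{L}$-norm), let $x_0\in\mathbb{H}$ and $\eta=\sqrt\mu$. For $r>1$ let $$\mathfrak{B}=\mathfrak{B}_r=\{x\in\mathbb{H}:\|x-x^*\|_{\mathcal{L}}\le R\},\qquad R=\sqrt{\tfrac{2}{\mu}(G(x_0)-G^* )}+\tfrac1\eta\sqrt{2r(G(x_0)-G^* )},$$ let $L_B>0$ be a Lipschitz smoothness constant of $G$ associated with $\mathfrak{B}$, and consider the step size condition $$s\in\left(0,\ \min\left\{L_B^{-1},\ \left(\tfrac{r-1}{r+1}\right)^2\mu^{-1}\right\}\right].\qquad ( * )$$ Then for a suitable $r>1$ (with a Lipschitz smoothness constant $L_B$ associated with $\mathfrak{B}_r$) the choice $s=1/L_B$ satisfies $( * )$. Moreover, whenever $s=1/L_B$ satisfies $( * )$, the iterates of PAGD started from $x_0$ with friction coefficient $\eta=\sqrt\mu$ and step size $s=1/L_B$ satisfy, for all $k\ge0$, with $\rho=\mu/L_B$ and $E_0=\frac1\eta(G(x_0)-G^* )+\frac\eta2\|x_0-x^*\|_{\mathcal{L}}^2$, $$\frac1\eta(G(x_k)-G^* )+\frac\eta2\|v_k-x^*\|_{\mathcal{L}}^2\le(1-\sqrt\rho)^kE_0,$$ $$G(x_k)-G^*\le(1-\sqrt\rho)^k\,\eta E_0,\qquad \|x_k-x^*\|_{\mathcal{L}}\le(1-\sqrt\rho)^{k/2}\sqrt{\frac{2E_0}{\eta}},$$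 and $$\|G'(y_k)\|_{\mathcal{L}^{-1}}\le 3L_B\sqrt{\frac{2E_0}{\eta}}\,(1-\sqrt\rho)^{\frac{k-1}{2}}.$$
   Context: $\mathbb{H}$ is a real separable Hilbert space with norm $\|\cdot\|_{\mathbb{H}}$, $\mathbb{H}'$ is its dual, and $\langle f,v\rangle=f(v)$ is the duality pairing. The preconditioner $\mathcal{L}:\mathbb{H}\to\mathbb{H}'$ is a linear operator such that, with $(x,y)_{\mathcal{L}}:=\langle\mathcal{L}x,y\rangle$, there are $C_1,C_2>0$ with $(x,y)_{\mathcal{L}}=(y,x)_{\mathcal{L}}$, $(x,y)_{\mathcal{L}}\le C_2\|x\|_{\mathbb{H}}\|y\|_{\mathbb{H}}$, and $C_1\|x\|_{\mathbb{H}}^2\le (x,x)_{\mathcal{L}}$ for all $x,y\in\mathbb{H}$. Then $\|x\|_{\mathcal{L}}:=\sqrt{(x,x)_{\mathcal{L}}}$ is a norm equivalent to $\|\cdot\|_{\mathbb{H}}$, $\mathcal{L}$ is invertible, and $\|f\|_{\mathcal{L}^{-1}}:=\sqrt{\langle f,\mathcal{L}^{-1}f\rangle}$ is a norm on $\mathbb{H}'$. $G:\mathbb{H}\to\mathbb{R}$ is Fréchet differentiable at every point, with derivative $G'(x)\in\mathbb{H}'$. $G$ is $\mu$-strongly convex if $\mu>0$ and $\langle G'(x)-G'(y),x-y\rangle\ge\mu\|x-y\|_{\mathcal{L}}^2$ for all $x,y\in\mathbb{H}$. $G$ is locally Lipschitz smooth if for every bounded convex set $B\subset\mathbb{H}$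 there is $L_B>0$ such that $\langle G'(x)-G'(y),x-y\rangle\le L_B\|x-y\|_{\mathcal{L}}^2$ for all $x,y\in B$; any such $L_B$ is called a (local) Lipschitz smoothness constant associated with $B$ (it need not be the smallest one). $x^*$ denotes the unique minimizer of $G$ over $\mathbb{H}$ and $G^*=G(x^* )$. PAGD (preconditioned accelerated gradient descent) with friction coefficient $\eta>0$, step size $s>0$ and initial guess $x_0\in\mathbb{H}$: set $\theta=\eta\sqrt{s}$, $\lambda=\frac{1-\theta}{1+\theta}$, $x_{-1}=v_0=x_0$, and for $k\ge0$ $$y_k=x_k+\lambda(x_k-x_{k-1}),\qquad x_{k+1}=y_k-s\,\mathcal{L}^{-1}G'(y_k),\qquad v_{k+1}=x_k+\tfrac1\theta(x_{k+1}-x_k).$$ *)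

theory Defs
  imports "HOL-Analysis.Analysis"
begin

text \<open>
  A real separable Hilbert space is a type of sort \<open>{real_inner, polish_space}\<close>; its dual is
  \<open>'a \<Rightarrow>\<^sub>L real\<close>, with \<open>f v\<close> (\<open>blinfun_apply\<close>) as duality pairing.
\<close>

definition preconditioner :: "('a::{real_inner, polish_space} \<Rightarrow> ('a \<Rightarrow>\<^sub>L real)) \<Rightarrow> bool" where
  "preconditioner \<L> \<longleftrightarrow> linear \<L> \<and>
     (\<forall>x y. \<L> x y = \<L> y x) \<and>
     (\<exists>C1>0. \<exists>C2>0. \<forall>x y. \<L> x y \<le> C2 * norm x * norm y \<and> C1 * (norm x)\<^sup>2 \<le> \<L> x x)"

definition precond_norm :: "('a::{real_inner, polish_space} \<Rightarrow> ('a \<Rightarrow>\<^sub>L real)) \<Rightarrow> 'a \<Rightarrow> real" where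
  "precond_norm \<L> x = sqrt (\<L> x x)"

text \<open>Every preconditioner is a bijection onto the dual, so \<open>inv \<L>\<close> is its two-sided inverse.\<close>

definition precond_dual_norm ::
    "('a::{real_inner, polish_space} \<Rightarrow> ('a \<Rightarrow>\<^sub>L real)) \<Rightarrow> ('a \<Rightarrow>\<^sub>L real) \<Rightarrow> real" where
  "precond_dual_norm \<L> f = sqrt (f (inv \<L> f))"

text \<open>In the following, \<open>G'\<close> stands for the Frechet derivative of the objective \<open>G\<close>.\<close>

definition strongly_convex ::
    "('a::{real_inner, polish_space} \<Rightarrow> ('a \<Rightarrow>\<^sub>L real)) \<Rightarrow> ('a \<Rightarrow> ('a \<Rightarrow>\<^sub>L real)) \<Rightarrow> real \<Rightarrow> bool" where
  "strongly_convex \<L> G' \<mu> \<longleftrightarrow> \<mu> > 0 \<and>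
     (\<forall>x y. (G' x - G' y) (x - y) \<ge> \<mu> * (precond_norm \<L> (x - y))\<^sup>2)"

definition smoothness_constant ::
    "('a::{real_inner, polish_space} \<Rightarrow> ('a \<Rightarrow>\<^sub>L real)) \<Rightarrow> ('a \<Rightarrow> ('a \<Rightarrow>\<^sub>L real)) \<Rightarrow> 'a set \<Rightarrow> real \<Rightarrow> bool"
  where
  "smoothness_constant \<L> G' B L \<longleftrightarrow> L > 0 \<and>
     (\<forall>x\<in>B. \<forall>y\<in>B. (G' x - G' y) (x - y) \<le> L * (precond_norm \<L> (x - y))\<^sup>2)"

definition locally_lipschitz_smooth ::
    "('a::{real_inner, polish_space} \<Rightarrow> ('a \<Rightarrow>\<^sub>L real)) \<Rightarrow> ('a \<Rightarrow> ('a \<Rightarrow>\<^sub>L real)) \<Rightarrow> bool" where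
  "locally_lipschitz_smooth \<L> G' \<longleftrightarrow>
     (\<forall>B. bounded B \<and> convex B \<longrightarrow> (\<exists>L. smoothness_constant \<L> G' B L))"

text \<open>Well defined for strongly convex \<open>G\<close>, which has exactly one global minimizer.\<close>

definition minimizer :: "('a \<Rightarrow> real) \<Rightarrow> 'a" where
  "minimizer G = (THE x. \<forall>y. G x \<le> G y)"

definition pagd_theta :: "real \<Rightarrow> real \<Rightarrow> real" where
  "pagd_theta \<eta> s = \<eta> * sqrt s"

definition pagd_lambda :: "real \<Rightarrow> real \<Rightarrow> real" where
  "pagd_lambda \<eta> s = (1 - pagd_theta \<eta> s) / (1 + pagd_theta \<eta> s)"

definition pagd_extrapolate :: "real \<Rightarrow> real \<Rightarrow> 'a::real_vector \<Rightarrow> 'a \<Rightarrow> 'a" where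
  "pagd_extrapolate \<eta> s xprev xcur = xcur + pagd_lambda \<eta> s *\<^sub>R (xcur - xprev)"

text \<open>\<open>pagd_state \<L> G' \<eta> s x0 k\<close> is the pair of \<open>x\<^bsub>k-1\<^esub>\<close> and \<open>x\<^bsub>k\<^esub>\<close>.\<close>

primrec pagd_state ::
    "('a::{real_inner, polish_space} \<Rightarrow> ('a \<Rightarrow>\<^sub>L real)) \<Rightarrow> ('a \<Rightarrow> ('a \<Rightarrow>\<^sub>L real)) \<Rightarrow> real \<Rightarrow> real \<Rightarrow> 'a \<Rightarrow>
     nat \<Rightarrow> 'a \<times> 'a" where
  "pagd_state \<L> G' \<eta> s x0 0 = (x0, x0)"
| "pagd_state \<L> G' \<eta> s x0 (Suc k) =
     (let (xprev, xcur) = pagd_state \<L> G' \<eta> s x0 k;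
          y = pagd_extrapolate \<eta> s xprev xcur
      in (xcur, y - s *\<^sub>R inv \<L> (G' y)))"

definition pagd_x ::
    "('a::{real_inner, polish_space} \<Rightarrow> ('a \<Rightarrow>\<^sub>L real)) \<Rightarrow> ('a \<Rightarrow> ('a \<Rightarrow>\<^sub>L real)) \<Rightarrow> real \<Rightarrow> real \<Rightarrow> 'a \<Rightarrow>
     nat \<Rightarrow> 'a" where
  "pagd_x \<L> G' \<eta> s x0 k = snd (pagd_state \<L> G' \<eta> s x0 k)"

definition pagd_y ::
    "('a::{real_inner, polish_space} \<Rightarrow> ('a \<Rightarrow>\<^sub>L real)) \<Rightarrow> ('a \<Rightarrow> ('a \<Rightarrow>\<^sub>L real)) \<Rightarrow> real \<Rightarrow> real \<Rightarrow> 'a \<Rightarrow>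
     nat \<Rightarrow> 'a" where
  "pagd_y \<L> G' \<eta> s x0 k =
     (let (xprev, xcur) = pagd_state \<L> G' \<eta> s x0 k in pagd_extrapolate \<eta> s xprev xcur)"

primrec pagd_v ::
    "('a::{real_inner, polish_space} \<Rightarrow> ('a \<Rightarrow>\<^sub>L real)) \<Rightarrow> ('a \<Rightarrow> ('a \<Rightarrow>\<^sub>L real)) \<Rightarrow> real \<Rightarrow> real \<Rightarrow> 'a \<Rightarrow>
     nat \<Rightarrow> 'a" where
  "pagd_v \<L> G' \<eta> s x0 0 = x0"
| "pagd_v \<L> G' \<eta> s x0 (Suc k) =
     pagd_x \<L> G' \<eta> s x0 k +
     (1 / pagd_theta \<eta> s) *\<^sub>R (pagd_x \<L> G' \<eta> s x0 (Suc k) - pagd_x \<L> G' \<eta> s x0 k)"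

text \<open>The ball written \<open>B\<^sub>r\<close> in the step size condition; here \<open>\<eta> = sqrt \<mu>\<close>.\<close>

definition pagd_radius :: "('a \<Rightarrow> real) \<Rightarrow> real \<Rightarrow> 'a \<Rightarrow> real \<Rightarrow> real" where
  "pagd_radius G \<mu> x0 r =
     sqrt (2 / \<mu> * (G x0 - G (minimizer G))) +
     1 / sqrt \<mu> * sqrt (2 * r * (G x0 - G (minimizer G)))"

definition pagd_ball ::
    "('a::{real_inner, polish_space} \<Rightarrow> ('a \<Rightarrow>\<^sub>L real)) \<Rightarrow> ('a \<Rightarrow> real) \<Rightarrow> real \<Rightarrow> 'a \<Rightarrow> real \<Rightarrow> 'a set" where
  "pagd_ball \<L> G \<mu> x0 r = {x. precond_norm \<L> (x - minimizer G) \<le> pagd_radius G \<mu> x0 r}"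

definition step_size_condition :: "real \<Rightarrow> real \<Rightarrow> real \<Rightarrow> real \<Rightarrow> bool" where
  "step_size_condition \<mu> r L s \<longleftrightarrow> s \<in> {0 <.. min (1 / L) (((r - 1) / (r + 1))\<^sup>2 * (1 / \<mu>))}"

definition pagd_energy ::
    "('a::{real_inner, polish_space} \<Rightarrow> ('a \<Rightarrow>\<^sub>L real)) \<Rightarrow> ('a \<Rightarrow> real) \<Rightarrow> real \<Rightarrow> 'a \<Rightarrow> 'a \<Rightarrow> real" where
  "pagd_energy \<L> G \<eta> x v =
     1 / \<eta> * (G x - G (minimizer G)) + \<eta> / 2 * (precond_norm \<L> (v - minimizer G))\<^sup>2"

end

theory Submission
  imports Defs
begin

text \<open>
  Write \<open>sqnorm x = \<L> x x\<close> for the square of the preconditioned norm, \<open>x*\<close> for the minimizer and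
  \<open>g = \<L>\<inverse> G'(y)\<close> for the preconditioned gradient at \<open>y\<close>.

  A strongly convex function lies above its tangent quadratics, so a minimizing sequence is Cauchy and
  \<open>x*\<close> exists (\<open>ex_minimizer\<close>). The same fact, applied to \<open>x \<mapsto> \<L> x x / 2 - f x\<close>, shows that \<open>\<L>\<close> is
  onto the dual, so that \<open>inv \<L>\<close> is a right inverse (\<open>surj\<close>).

  Smoothness is only available on a ball around \<open>x*\<close>, so both \<open>y\<close> and the new iterate \<open>y - g / L\<close> have to be
  located in that ball before the descent estimate \<open>G (y - g / L) \<le> G y - sqnorm g / (2 L)\<close> can
  be used. For a partial step \<open>y - (t / L) g\<close> with \<open>0 \<le> t \<le> 1\<close> that lies in the ball, the descent
  estimate and \<open>G x* \<le> G (y - (t / L) g)\<close> together show that the step does not increase the distance to \<open>x*\<close>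
  (\<open>gradient_step_within_ball\<close>). If \<open>y\<close> is in the interior of the ball, the segment can
  therefore never reach the boundary sphere, by the intermediate value theorem (\<open>gradient_step\<close>).

  Given the descent estimate, the potential \<open>G x - G x* + \<mu>/2 sqnorm (v - x*)\<close>, which is \<open>\<eta>\<close> times the
  energy, contracts by the factor \<open>1 - \<theta>\<close> with \<open>\<theta> = sqrt (\<mu> / L)\<close> in each step
  (\<open>potential_step\<close>); the computation uses \<open>(1 + \<theta>) y\<^sub>k = x\<^sub>k + \<theta> v\<^sub>k\<close>. The same identity makes \<open>y\<^sub>k\<close> a convex
  combination of \<open>x\<^sub>k\<close> and \<open>v\<^sub>k\<close>, whose squared distances to \<open>x*\<close> are at most \<open>2/\<mu>\<close> times the
  potential. As the potential decreases, \<open>y\<^sub>k\<close> stays well inside the ball, and the induction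
  closes (\<open>pagd_convergence\<close>). The gradient bound follows from \<open>g\<^sub>k = L (y\<^sub>k - x\<^bsub>k+1\<^esub>)\<close>,
  where \<open>x\<^bsub>k+1\<^esub>\<close> is no farther from \<open>x*\<close> than \<open>y\<^sub>k\<close>; it gives the constant \<open>2\<close> in place of \<open>3\<close>.
\<close>

section \<open>The inner product of a preconditioner\<close>

text \<open>
  Comparing \<open>t \<mapsto> F (x + t d)\<close> with a quadratic in \<open>t\<close> needs only the pointwise derivative, not its
  continuity. Applied to \<open>- G\<close> this gives the strong convexity bound, applied to \<open>G\<close> the descent
  estimate.
\<close>

lemma increment_le_of_derivative_le:
  fixes F :: "'a::real_normed_vector \<Rightarrow> real"
  assumes F: "\<And>z. (F has_derivative blinfun_apply (F' z)) (at z)"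
    and bound: "\<And>t. 0 < t \<Longrightarrow> t \<le> 1 \<Longrightarrow> F' (x + t *\<^sub>R d) d - F' x d \<le> c * t"
  shows "F (x + d) \<le> F x + F' x d + c / 2"
proof -
  define \<phi> where "\<phi> t = F (x + t *\<^sub>R d) - t * F' x d - c / 2 * t\<^sup>2" for t
  have deriv: "(\<phi> has_real_derivative (F' (x + t *\<^sub>R d) d - F' x d - c * t)) (at t)" for t
  proof -
    have "((\<lambda>t. x + t *\<^sub>R d) has_derivative (\<lambda>h. h *\<^sub>R d)) (at t)"
      by (auto intro!: derivative_eq_intros)
    from has_derivative_compose[OF this F]
    have "((\<lambda>t. F (x + t *\<^sub>R d)) has_derivative (\<lambda>h. F' (x + t *\<^sub>R d) (h *\<^sub>R d))) (at t)" .
    then have "((\<lambda>t. F (x + t *\<^sub>R d)) has_real_derivative F' (x + t *\<^sub>R d) d) (at t)"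
      by (simp add: has_field_derivative_def blinfun.scaleR_right mult.commute[of _ "F' (x + t *\<^sub>R d) d"])
    then show ?thesis
      unfolding \<phi>_def by (auto intro!: derivative_eq_intros)
  qed
  have "\<phi> 1 \<le> \<phi> 0"
  proof (rule DERIV_nonpos_imp_nonincreasing[of 0 1 \<phi>])
    fix t :: real assume "0 \<le> t" "t \<le> 1"
    then have "F' (x + t *\<^sub>R d) d - F' x d - c * t \<le> 0"
      using bound[of t] by (cases "t = 0") auto
    with deriv show "\<exists>D. (\<phi> has_real_derivative D) (at t) \<and> D \<le> 0" by blast
  qed simp
  then show ?thesis by (simp add: \<phi>_def)
qed

text \<open>A Hilbert space with the inner product \<open>\<L> x y\<close> induced by a preconditioner.\<close>

locale preconditioned_space =
  fixes \<L> :: "'a::{real_inner, polish_space} \<Rightarrow> ('a \<Rightarrow>\<^sub>L real)"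
  assumes preconditioner: "preconditioner \<L>"
begin

abbreviation sqnorm :: "'a \<Rightarrow> real" where
  "sqnorm x \<equiv> \<L> x x"

lemma sym: "\<L> x y = \<L> y x"
  using preconditioner unfolding preconditioner_def by blast

lemma linear: "linear \<L>"
  using preconditioner unfolding preconditioner_def by blast

lemmas bilinear =
  linear_add[OF linear] linear_diff[OF linear] linear_scale[OF linear] linear_neg[OF linear]
  linear_0[OF linear] blinfun.bilinear_simps

lemma coercive: obtains c where "c > 0" "\<And>x. c * (norm x)\<^sup>2 \<le> sqnorm x"
  using preconditioner unfolding preconditioner_def by blast

lemma sqnorm_ge_0: "0 \<le> sqnorm x"
proof -
  obtain c where c: "c > 0" "\<And>x. c * (norm x)\<^sup>2 \<le> sqnorm x" using coercive by blast
  have "0 \<le> c * (norm x)\<^sup>2" using c(1) by simp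
  with c(2)[of x] show ?thesis by linarith
qed

lemma sqnorm_eq_0_iff: "sqnorm x = 0 \<longleftrightarrow> x = 0"
proof
  assume 0: "sqnorm x = 0"
  obtain c where c: "c > 0" "\<And>x. c * (norm x)\<^sup>2 \<le> sqnorm x" using coercive by blast
  from c(2)[of x] 0 have "c * (norm x)\<^sup>2 \<le> 0" by simp
  with c(1) have "(norm x)\<^sup>2 \<le> 0" by (simp add: mult_le_0_iff)
  then show "x = 0" by simp
qed (simp add: bilinear)

lemma precond_norm_power2: "(precond_norm \<L> x)\<^sup>2 = sqnorm x"
  by (simp add: precond_norm_def sqnorm_ge_0)

lemma precond_norm_le_iff: "0 \<le> R \<Longrightarrow> precond_norm \<L> x \<le> R \<longleftrightarrow> sqnorm x \<le> R\<^sup>2"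
  unfolding precond_norm_def by (metis abs_of_nonneg real_sqrt_abs real_sqrt_le_iff)

lemma sqnorm_uminus: "sqnorm (- x) = sqnorm x"
  by (simp add: bilinear)

lemma sqnorm_scaleR: "sqnorm (t *\<^sub>R x) = t\<^sup>2 * sqnorm x"
  by (simp add: bilinear power2_eq_square)

lemma sqnorm_add: "sqnorm (a + b) = sqnorm a + 2 * \<L> a b + sqnorm b"
  using sym[of b a] by (simp add: bilinear)

lemma sqnorm_diff: "sqnorm (a - b) = sqnorm a - 2 * \<L> a b + sqnorm b"
  using sym[of b a] by (simp add: bilinear)

lemma sqnorm_convex:
  assumes "0 \<le> t" "t \<le> 1"
  shows "sqnorm ((1 - t) *\<^sub>R a + t *\<^sub>R b) \<le> (1 - t) * sqnorm a + t * sqnorm b"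
proof -
  have "(1 - t) * sqnorm a + t * sqnorm b - sqnorm ((1 - t) *\<^sub>R a + t *\<^sub>R b)
      = t * (1 - t) * sqnorm (a - b)"
    using sym[of b a] by (simp add: bilinear algebra_simps)
  also have "\<dots> \<ge> 0" using assms sqnorm_ge_0 by simp
  finally show ?thesis by simp
qed

lemma sqnorm_convex_le:
  assumes "0 \<le> t" "t \<le> 1" "sqnorm a \<le> c" "sqnorm b \<le> c"
  shows "sqnorm ((1 - t) *\<^sub>R a + t *\<^sub>R b) \<le> c"
proof -
  have "(1 - t) * sqnorm a + t * sqnorm b \<le> (1 - t) * c + t * c"
    using assms by (intro add_mono mult_left_mono) auto
  also have "\<dots> = c" by (simp add: algebra_simps)
  finally show ?thesis using sqnorm_convex[of t a b] assms by linarith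
qed

lemma sqnorm_diff_le: "sqnorm (a - b) \<le> 2 * sqnorm a + 2 * sqnorm b"
  using sqnorm_ge_0[of "a + b"] unfolding sqnorm_diff sqnorm_add by linarith

lemma bounded_linear: "bounded_linear \<L>"
proof -
  obtain C where C: "C > 0" "\<And>x y. \<L> x y \<le> C * norm x * norm y"
    using preconditioner unfolding preconditioner_def by blast
  have "norm (\<L> x) \<le> norm x * C" for x
  proof (rule norm_blinfun_bound)
    fix y
    have "\<L> x y \<le> norm x * C * norm y" using C(2)[of x y] by (simp add: mult.commute)
    moreover have "- \<L> x y \<le> norm x * C * norm y"
      using C(2)[of x "- y"] by (simp add: bilinear mult.commute)
    ultimately show "norm (\<L> x y) \<le> norm x * C * norm y" by simp
  qed (use C in simp)
  then show ?thesis
    using linear by (intro bounded_linear_intro[where K = C]) (auto simp: bilinear)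
qed

lemma bounded_energy_ball: "bounded {x. precond_norm \<L> (x - z) \<le> R}"
proof -
  obtain c where c: "c > 0" "\<And>x. c * (norm x)\<^sup>2 \<le> sqnorm x" using coercive by blast
  have "norm (x - z) \<le> sqrt (R\<^sup>2 / c)" if "precond_norm \<L> (x - z) \<le> R" for x
  proof (rule real_le_rsqrt)
    have "0 \<le> precond_norm \<L> (x - z)" by (simp add: precond_norm_def sqnorm_ge_0)
    then have "sqnorm (x - z) \<le> R\<^sup>2" using that precond_norm_le_iff[of R "x - z"] by linarith
    with c(2)[of "x - z"] have "c * (norm (x - z))\<^sup>2 \<le> R\<^sup>2" by linarith
    then show "(norm (x - z))\<^sup>2 \<le> R\<^sup>2 / c" using c(1) by (simp add: field_simps)
  qed
  then have "{x. precond_norm \<L> (x - z) \<le> R} \<subseteq> cball z (sqrt (R\<^sup>2 / c))"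
    by (auto simp: dist_norm norm_minus_commute)
  then show ?thesis using bounded_cball bounded_subset by blast
qed

lemma convex_energy_ball: "convex {x. precond_norm \<L> (x - z) \<le> R}"
proof (rule convexI)
  fix x y and u v :: real
  assume x: "x \<in> {x. precond_norm \<L> (x - z) \<le> R}" and y: "y \<in> {x. precond_norm \<L> (x - z) \<le> R}"
    and uv: "0 \<le> u" "0 \<le> v" "u + v = 1"
  have "0 \<le> precond_norm \<L> (x - z)" by (simp add: precond_norm_def sqnorm_ge_0)
  with x have R: "0 \<le> R" by simp
  have u: "u = 1 - v" using uv by simp
  have eq: "u *\<^sub>R x + v *\<^sub>R y - z = (1 - v) *\<^sub>R (x - z) + v *\<^sub>R (y - z)"
    unfolding u by (simp add: algebra_simps)
  have "sqnorm (u *\<^sub>R x + v *\<^sub>R y - z) \<le> R\<^sup>2"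
    unfolding eq by (rule sqnorm_convex_le) (use x y uv R precond_norm_le_iff in auto)
  then show "u *\<^sub>R x + v *\<^sub>R y \<in> {x. precond_norm \<L> (x - z) \<le> R}"
    using precond_norm_le_iff[OF R] by simp
qed

end

section \<open>Strongly convex functions and their minimizers\<close>

text \<open>
  A Frechet differentiable function that is \<open>\<mu>\<close>-strongly convex in the preconditioned norm.
\<close>

locale strongly_convex_function = preconditioned_space \<L>
  for \<L> :: "'a::{real_inner, polish_space} \<Rightarrow> ('a \<Rightarrow>\<^sub>L real)" +
  fixes G :: "'a \<Rightarrow> real" and G' :: "'a \<Rightarrow> ('a \<Rightarrow>\<^sub>L real)" and \<mu> :: real
  assumes deriv: "\<And>x. (G has_derivative blinfun_apply (G' x)) (at x)"
    and strongly_convex: "strongly_convex \<L> G' \<mu>"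
begin

lemma mu_pos: "\<mu> > 0"
  using strongly_convex unfolding strongly_convex_def by blast

lemma strongly_monotone: "\<mu> * sqnorm (x - y) \<le> (G' x - G' y) (x - y)"
  using strongly_convex unfolding strongly_convex_def precond_norm_power2 by blast

lemma quadratic_lower_bound: "G x + G' x (y - x) + \<mu> / 2 * sqnorm (y - x) \<le> G y"
proof -
  have "- G (x + (y - x)) \<le> - G x + (- G' x) (y - x) + (- \<mu> * sqnorm (y - x)) / 2"
  proof (rule increment_le_of_derivative_le[where F = "\<lambda>z. - G z" and F' = "\<lambda>z. - G' z"])
    fix z
    have "blinfun_apply (- G' z) = (\<lambda>h. - G' z h)" by (auto simp: blinfun.bilinear_simps)
    then show "((\<lambda>z. - G z) has_derivative blinfun_apply (- G' z)) (at z)"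
      using has_derivative_minus[OF deriv[of z]] by simp
  next
    fix t :: real assume t: "0 < t" "t \<le> 1"
    have "t * (\<mu> * t * sqnorm (y - x)) \<le> t * ((G' (x + t *\<^sub>R (y - x)) - G' x) (y - x))"
      using strongly_monotone[of "x + t *\<^sub>R (y - x)" x]
      by (simp add: linear_scale[OF linear] blinfun.scaleR_left blinfun.scaleR_right mult_ac)
    then have "\<mu> * t * sqnorm (y - x) \<le> (G' (x + t *\<^sub>R (y - x)) - G' x) (y - x)"
      using t(1) by simp
    then show "(- G' (x + t *\<^sub>R (y - x))) (y - x) - (- G' x) (y - x) \<le> - \<mu> * sqnorm (y - x) * t"
      by (simp add: blinfun.bilinear_simps mult_ac)
  qed
  then show ?thesis by (simp add: blinfun.bilinear_simps)
qed

lemma sqnorm_diff_le_gap: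
  "\<mu> / 4 * sqnorm (x - y) \<le> G x + G y - 2 * G ((1 / 2) *\<^sub>R (x + y))"
proof -
  let ?m = "(1 / 2) *\<^sub>R (x + y)"
  have half: "z = (1 / 2) *\<^sub>R z + (1 / 2) *\<^sub>R z" for z :: 'a
    by (simp flip: scaleR_left_distrib)
  have x: "x - ?m = (1 / 2) *\<^sub>R (x - y)"
    by (subst half[of x]) (simp only: scaleR_right_distrib scaleR_right_diff_distrib, simp)
  have y: "y - ?m = (- 1 / 2) *\<^sub>R (x - y)"
    by (subst half[of y]) (simp only: scaleR_right_distrib scaleR_right_diff_distrib, simp)
  show ?thesis
    using quadratic_lower_bound[of ?m x] quadratic_lower_bound[of ?m y]
      sqnorm_scaleR[of "1 / 2" "x - y"] sqnorm_scaleR[of "- 1 / 2" "x - y"]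
    unfolding x y by (simp add: blinfun.scaleR_right blinfun.minus_right sqnorm_uminus
        linear_scale[OF linear] linear_neg[OF linear] blinfun.scaleR_left blinfun.minus_left
        power2_eq_square)
qed

lemma bounded_below: "bdd_below (range G)"
proof -
  obtain c where c: "c > 0" "\<And>x. c * (norm x)\<^sup>2 \<le> sqnorm x" using coercive by blast
  define a where "a = \<mu> / 2 * c"
  define K where "K = norm (G' 0)"
  have a: "a > 0" using c(1) mu_pos by (simp add: a_def)
  have "G 0 - K\<^sup>2 / (4 * a) \<le> G y" for y
  proof -
    have "- (K * norm y) \<le> G' 0 y" using norm_blinfun[of "G' 0" y] by (simp add: K_def)
    moreover have "a * (norm y)\<^sup>2 \<le> \<mu> / 2 * sqnorm y"
      using c(2)[of y] mu_pos by (simp add: a_def)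
    moreover have "G 0 + G' 0 y + \<mu> / 2 * sqnorm y \<le> G y"
      using quadratic_lower_bound[of 0 y] by simp
    moreover have "0 \<le> a * (norm y)\<^sup>2 - K * norm y + K\<^sup>2 / (4 * a)"
    proof -
      have "a * (norm y)\<^sup>2 - K * norm y + K\<^sup>2 / (4 * a) = (2 * a * norm y - K)\<^sup>2 / (4 * a)"
        using a by (simp add: field_simps power2_eq_square)
      then show ?thesis using a by simp
    qed
    ultimately show ?thesis by linarith
  qed
  then show ?thesis by (auto simp: bdd_below_def)
qed

lemma ex_minimizer: "\<exists>x. \<forall>y. G x \<le> G y"
proof -
  define m where "m = Inf (range G)"
  have m: "m \<le> G x" for x unfolding m_def using bounded_below by (simp add: cInf_lower)
  have "\<exists>x. G x < m + inverse (real (Suc n))" for n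
  proof -
    have "Inf (range G) < m + inverse (real (Suc n))" by (simp add: m_def)
    then show ?thesis using cInf_less_iff[OF _ bounded_below] by auto
  qed
  then obtain X where X: "\<And>n. G (X n) < m + inverse (real (Suc n))" by metis
  obtain c where c: "c > 0" "\<And>x. c * (norm x)\<^sup>2 \<le> sqnorm x" using coercive by blast
  define a where "a = \<mu> / 4 * c"
  have a: "a > 0" using c(1) mu_pos by (simp add: a_def)
  have dist: "a * (norm (X i - X j))\<^sup>2 < inverse (real (Suc i)) + inverse (real (Suc j))" for i j
  proof -
    have "a * (norm (X i - X j))\<^sup>2 \<le> \<mu> / 4 * sqnorm (X i - X j)"
      using c(2)[of "X i - X j"] mu_pos by (simp add: a_def)
    then show ?thesis
      using sqnorm_diff_le_gap[of "X i" "X j"] X[of i] X[of j] m[of "(1 / 2) *\<^sub>R (X i + X j)"]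
      by linarith
  qed
  \<comment> \<open>minimizing sequences are Cauchy, since the midpoint value is at least \<open>m\<close>\<close>
  have "Cauchy X"
  proof (rule CauchyI)
    fix e :: real assume e: "0 < e"
    then have "0 < a * e\<^sup>2 / 2" using a by simp
    then obtain N where N: "inverse (real (Suc N)) < a * e\<^sup>2 / 2" using reals_Archimedean by blast
    show "\<exists>M. \<forall>i\<ge>M. \<forall>j\<ge>M. norm (X i - X j) < e"
    proof (intro exI allI impI)
      fix i j assume "N \<le> i" "N \<le> j"
      then have "inverse (real (Suc i)) \<le> inverse (real (Suc N))"
        "inverse (real (Suc j)) \<le> inverse (real (Suc N))" by (auto intro!: le_imp_inverse_le)
      with dist[of i j] N have "a * (norm (X i - X j))\<^sup>2 < a * e\<^sup>2" by linarith
      then have "(norm (X i - X j))\<^sup>2 < e\<^sup>2" using a by simp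
      then show "norm (X i - X j) < e" using e by (simp add: power_less_imp_less_base)
    qed
  qed
  then obtain l where l: "X \<longlonglongrightarrow> l" using Cauchy_convergent convergent_def by blast
  have "(\<lambda>n. G (X n)) \<longlonglongrightarrow> G l"
    by (rule isCont_tendsto_compose[OF has_derivative_continuous[OF deriv] l])
  moreover have "(\<lambda>n. m + inverse (real (Suc n))) \<longlonglongrightarrow> m"
    using tendsto_add[OF tendsto_const LIMSEQ_inverse_real_of_nat, of m] by simp
  ultimately have "G l \<le> m" by (rule LIMSEQ_le) (use less_imp_le[OF X] in auto)
  then have "G l \<le> G y" for y using m[of y] by linarith
  then show ?thesis by blast
qed

lemma derivative_at_min:
  assumes "\<And>y. G x \<le> G y"
  shows "G' x = 0"
proof -
  have "blinfun_apply (G' x) = (\<lambda>h. 0)"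
    using differential_zero_maxmin[OF _ open_UNIV deriv[of x]] assms by auto
  then show ?thesis by (intro blinfun_eqI) simp
qed

lemma minimizer_le: "G (minimizer G) \<le> G y"
proof -
  obtain x where x: "\<forall>y. G x \<le> G y" using ex_minimizer by blast
  have "z = x" if z: "\<forall>y. G z \<le> G y" for z
  proof -
    have "G' x = 0" by (rule derivative_at_min) (use x in simp)
    moreover have "G z \<le> G x" using z by simp
    ultimately have "\<mu> / 2 * sqnorm (z - x) \<le> 0"
      using quadratic_lower_bound[of x z] by simp
    then have "sqnorm (z - x) \<le> 0"
      using mu_pos by (simp add: mult_le_0_iff)
    then have "sqnorm (z - x) = 0"
      using sqnorm_ge_0[of "z - x"] by linarith
    then show ?thesis by (simp add: sqnorm_eq_0_iff)
  qed
  then have "minimizer G = x" unfolding minimizer_def by (rule the_equality[where P = "\<lambda>x. \<forall>y. G x \<le> G y", OF x])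
  then show ?thesis using x by simp
qed

lemma derivative_minimizer: "G' (minimizer G) = 0"
  by (rule derivative_at_min) (rule minimizer_le)

lemma sqnorm_le_gap: "\<mu> / 2 * sqnorm (x - minimizer G) \<le> G x - G (minimizer G)"
  using quadratic_lower_bound[of "minimizer G" x] by (simp add: derivative_minimizer)

end

context preconditioned_space
begin

text \<open>
  The Riesz representation of \<open>f\<close> is the critical point of the quadratic functional
  \<open>x \<mapsto> \<L> x x / 2 - f x\<close>, which is strongly convex with constant \<open>1\<close>.
\<close>

lemma surj: "surj \<L>"
proof -
  have "\<exists>x. \<L> x = f" for f
  proof -
    interpret riesz: strongly_convex_function \<L> "\<lambda>x. 1 / 2 * \<L> x x - f x" "\<lambda>x. \<L> x - f" 1
    proof
      fix x
      have "((\<lambda>x. 1 / 2 * \<L> x x - f x) has_derivative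
          (\<lambda>h. 1 / 2 * (\<L> x h + \<L> h x) - f h)) (at x)"
        by (rule derivative_eq_intros bounded_linear_imp_has_derivative[OF bounded_linear]
            bounded_linear_imp_has_derivative[OF blinfun.bounded_linear_right] refl
            blinfun.FDERIV)+ auto
      moreover have "(\<lambda>h. 1 / 2 * (\<L> x h + \<L> h x) - f h) = blinfun_apply (\<L> x - f)"
        using sym by (auto simp: blinfun.bilinear_simps)
      ultimately show "((\<lambda>x. 1 / 2 * \<L> x x - f x) has_derivative blinfun_apply (\<L> x - f)) (at x)"
        by simp
    qed (simp add: strongly_convex_def precond_norm_power2 bilinear)
    show ?thesis using riesz.derivative_minimizer by auto
  qed
  then show ?thesis unfolding surj_def by metis
qed

lemma precond_inv: "\<L> (inv \<L> f) = f"
  by (rule surj_f_inv_f[OF surj])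

lemma precond_dual_norm_eq: "precond_dual_norm \<L> f = precond_norm \<L> (inv \<L> f)"
  by (simp add: precond_dual_norm_def precond_norm_def precond_inv)

end

section \<open>One step of the accelerated method\<close>

context strongly_convex_function
begin

text \<open>The preconditioned gradient, that is, the Riesz representative of \<open>G' x\<close>.\<close>

abbreviation grad :: "'a \<Rightarrow> 'a" where
  "grad x \<equiv> inv \<L> (G' x)"

lemma grad_apply: "\<L> (grad x) h = G' x h"
  by (simp add: precond_inv)

lemma grad_minimizer: "grad (minimizer G) = 0"
proof -
  have "sqnorm (grad (minimizer G)) = G' (minimizer G) (grad (minimizer G))"
    by (rule grad_apply)
  then have "sqnorm (grad (minimizer G)) = 0" by (simp add: derivative_minimizer)
  then show ?thesis by (simp add: sqnorm_eq_0_iff)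
qed

lemma grad_lower_bound:
  "G y - G x + \<mu> / 2 * sqnorm (y - x) \<le> \<L> (grad y) (y - x)"
proof -
  have "sqnorm (x - y) = sqnorm (y - x)" using sqnorm_uminus[of "y - x"] by simp
  moreover have "G' y (x - y) = - G' y (y - x)" by (simp add: blinfun.diff_right)
  ultimately show ?thesis using quadratic_lower_bound[of y x] by (simp add: grad_apply)
qed

lemma descent:
  assumes smooth: "\<And>x y. sqnorm (x - z) \<le> c \<Longrightarrow> sqnorm (y - z) \<le> c \<Longrightarrow>
      (G' x - G' y) (x - y) \<le> L * sqnorm (x - y)"
    and x: "sqnorm (x - z) \<le> c" and xd: "sqnorm (x + d - z) \<le> c"
  shows "G (x + d) \<le> G x + G' x d + L / 2 * sqnorm d"
proof -
  have "G (x + d) \<le> G x + G' x d + (L * sqnorm d) / 2"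
  proof (rule increment_le_of_derivative_le[OF deriv])
    fix t :: real assume t: "0 < t" "t \<le> 1"
    have "x + t *\<^sub>R d - z = (1 - t) *\<^sub>R (x - z) + t *\<^sub>R (x + d - z)"
      by (simp add: algebra_simps)
    then have "sqnorm (x + t *\<^sub>R d - z) \<le> c"
      using sqnorm_convex_le[of t "x - z" c "x + d - z"] t x xd by simp
    from smooth[OF this x]
    have "(G' (x + t *\<^sub>R d) - G' x) (t *\<^sub>R d) \<le> L * (t\<^sup>2 * sqnorm d)"
      by (simp add: sqnorm_scaleR[of t d])
    then have "t * (G' (x + t *\<^sub>R d) d - G' x d) \<le> t * (L * sqnorm d * t)"
      by (simp add: blinfun.scaleR_right blinfun.diff_left power2_eq_square algebra_simps)
    then show "G' (x + t *\<^sub>R d) d - G' x d \<le> L * sqnorm d * t"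
      using t(1) by simp
  qed
  then show ?thesis by simp
qed

text \<open>
  Non-expansiveness of a partial gradient step needs the local cocoercivity
  \<open>(t - t\<^sup>2 / 2) / L * sqnorm (grad y) \<le> \<L> (grad y) (y - x*)\<close>, obtained by comparing the value at the
  end of the step with the minimum.
\<close>

lemma gradient_step_within_ball:
  assumes L: "L > 0"
    and smooth: "\<And>x y. sqnorm (x - minimizer G) \<le> c \<Longrightarrow> sqnorm (y - minimizer G) \<le> c \<Longrightarrow>
      (G' x - G' y) (x - y) \<le> L * sqnorm (x - y)"
    and y: "sqnorm (y - minimizer G) \<le> c"
    and t: "0 \<le> t" "t \<le> 1"
    and z: "sqnorm (y - (t / L) *\<^sub>R grad y - minimizer G) \<le> c"
  shows "G (y - (t / L) *\<^sub>R grad y) \<le> G y - (t - t\<^sup>2 / 2) / L * sqnorm (grad y)"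
    and "sqnorm (y - (t / L) *\<^sub>R grad y - minimizer G) \<le> sqnorm (y - minimizer G)"
proof -
  let ?m = "minimizer G" and ?g = "grad y"
  have "G (y + - ((t / L) *\<^sub>R ?g)) \<le>
      G y + G' y (- ((t / L) *\<^sub>R ?g)) + L / 2 * sqnorm (- ((t / L) *\<^sub>R ?g))"
    by (rule descent[where z = ?m and c = c, OF smooth y]) (use z in auto)
  also have "sqnorm (- ((t / L) *\<^sub>R ?g)) = (t / L)\<^sup>2 * sqnorm ?g"
    by (simp only: sqnorm_uminus sqnorm_scaleR)
  also have "G' y (- ((t / L) *\<^sub>R ?g)) = - (t / L) * sqnorm ?g"
    by (simp add: blinfun.bilinear_simps grad_apply)
  also have "G y + - (t / L) * sqnorm ?g + L / 2 * ((t / L)\<^sup>2 * sqnorm ?g)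
      = G y - (t - t\<^sup>2 / 2) / L * sqnorm ?g"
    using L by (simp add: field_simps power2_eq_square)
  finally show *: "G (y - (t / L) *\<^sub>R ?g) \<le> G y - (t - t\<^sup>2 / 2) / L * sqnorm ?g"
    by simp
  let ?p = "\<L> ?g (y - ?m)"
  have "0 \<le> \<mu> / 2 * sqnorm (y - ?m)" using mu_pos sqnorm_ge_0[of "y - ?m"] by simp
  then have "(t - t\<^sup>2 / 2) / L * sqnorm ?g \<le> ?p"
    using * minimizer_le[of "y - (t / L) *\<^sub>R ?g"] grad_lower_bound[of y ?m] by linarith
  then have "2 * (t / L) * ((t - t\<^sup>2 / 2) / L * sqnorm ?g) \<le> 2 * (t / L) * ?p"
    using t L by (intro mult_left_mono) auto
  moreover have "2 * (t / L) * ((t - t\<^sup>2 / 2) / L * sqnorm ?g)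
      = (t / L)\<^sup>2 * sqnorm ?g + (t / L)\<^sup>2 * (1 - t) * sqnorm ?g"
    using L by (simp add: field_simps power2_eq_square)
  moreover have "0 \<le> (t / L)\<^sup>2 * (1 - t) * sqnorm ?g"
    using t sqnorm_ge_0[of ?g] by simp
  moreover have "sqnorm (y - (t / L) *\<^sub>R ?g - ?m)
      = sqnorm (y - ?m) - 2 * (t / L) * ?p + (t / L)\<^sup>2 * sqnorm ?g"
  proof -
    have "y - (t / L) *\<^sub>R ?g - ?m = (y - ?m) - (t / L) *\<^sub>R ?g" by simp
    then show ?thesis
      using sym[of "y - ?m" ?g]
      by (simp only: sqnorm_diff[of "y - ?m" "(t / L) *\<^sub>R ?g"] sqnorm_scaleR[of "t / L" ?g]
          blinfun.scaleR_right[of "\<L> (y - ?m)"] real_scaleR_def)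
  qed
  ultimately show "sqnorm (y - (t / L) *\<^sub>R ?g - ?m) \<le> sqnorm (y - ?m)" by linarith
qed

text \<open>
  Here the membership of the new point in the ball is a conclusion instead of a hypothesis. If
  \<open>y\<close> is the minimizer, then the step vanishes, and \<open>c\<close> is irrelevant; this covers the ball of
  radius \<open>0\<close>.
\<close>

lemma gradient_step:
  assumes L: "L > 0"
    and smooth: "\<And>x y. sqnorm (x - minimizer G) \<le> c \<Longrightarrow> sqnorm (y - minimizer G) \<le> c \<Longrightarrow>
      (G' x - G' y) (x - y) \<le> L * sqnorm (x - y)"
    and y: "sqnorm (y - minimizer G) < c \<or> y = minimizer G"
  shows "G (y - (1 / L) *\<^sub>R grad y) \<le> G y - sqnorm (grad y) / (2 * L)"
    and "sqnorm (y - (1 / L) *\<^sub>R grad y - minimizer G) \<le> sqnorm (y - minimizer G)"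
proof -
  let ?m = "minimizer G" and ?g = "grad y"
  define h where "h t = sqnorm (y - (t / L) *\<^sub>R ?g - ?m)" for t
  have "G (y - (1 / L) *\<^sub>R ?g) \<le> G y - sqnorm ?g / (2 * L) \<and> h 1 \<le> sqnorm (y - ?m)"
  proof (cases "y = ?m")
    case True
    then have "?g = 0" by (simp add: grad_minimizer)
    then show ?thesis by (simp add: h_def bilinear)
  next
    case False
    with y have y: "sqnorm (y - ?m) < c" by simp
    have cont: "continuous_on {0..1} h"
      unfolding h_def
      by (intro continuous_intros bounded_linear.continuous_on[OF bounded_linear]) (use L in auto)
    have "h 1 \<le> c"
    proof (rule ccontr)
      assume "\<not> h 1 \<le> c"
      \<comment> \<open>at a time on the boundary sphere the distance would not exceed that of the interior point \<open>y\<close>\<close>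
      then obtain t where t: "0 \<le> t" "t \<le> 1" "h t = c"
        using IVT'[of h 0 c 1] cont y by (auto simp: h_def)
      then have "h t \<le> sqnorm (y - ?m)"
        using gradient_step_within_ball(2)[where c = c, OF L smooth less_imp_le[OF y], of t]
        by (auto simp: h_def)
      then show False using t(3) y by simp
    qed
    then show ?thesis
      using gradient_step_within_ball[where c = c, OF L smooth less_imp_le[OF y], of 1]
      by (simp add: h_def)
  qed
  then show "G (y - (1 / L) *\<^sub>R ?g) \<le> G y - sqnorm ?g / (2 * L)"
    and "sqnorm (y - (1 / L) *\<^sub>R ?g - ?m) \<le> sqnorm (y - ?m)"
    by (simp_all add: h_def)
qed

text \<open>
  The Lyapunov function: \<open>\<eta>\<close> times the energy for \<open>\<eta> = sqrt \<mu>\<close>, which avoids square roots of \<open>\<mu>\<close>.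
\<close>

definition potential :: "'a \<Rightarrow> 'a \<Rightarrow> real" where
  "potential x v = G x - G (minimizer G) + \<mu> / 2 * sqnorm (v - minimizer G)"

lemma pagd_energy_eq: "pagd_energy \<L> G (sqrt \<mu>) x v = potential x v / sqrt \<mu>"
proof -
  have "\<mu> / 2 * q / sqrt \<mu> = (\<mu> / sqrt \<mu>) / 2 * q" for q by simp
  also have "(\<mu> / sqrt \<mu>) / 2 * q = sqrt \<mu> / 2 * q" for q
    using mu_pos by (simp add: real_div_sqrt)
  finally show ?thesis
    by (simp add: pagd_energy_def potential_def precond_norm_power2 add_divide_distrib)
qed

lemma potential_ge_0: "0 \<le> potential x v"
  using minimizer_le[of x] sqnorm_ge_0[of "v - minimizer G"] mu_pos by (simp add: potential_def)

lemma gap_le_potential: "G x - G (minimizer G) \<le> potential x v"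
  using sqnorm_ge_0[of "v - minimizer G"] mu_pos by (simp add: potential_def)

lemma sqnorm_le_potential:
  "sqnorm (x - minimizer G) \<le> 2 / \<mu> * potential x v"
  "sqnorm (v - minimizer G) \<le> 2 / \<mu> * potential x v"
proof -
  have "\<mu> / 2 * sqnorm (x - minimizer G) \<le> potential x v"
    using sqnorm_le_gap[of x] gap_le_potential[of x v] by linarith
  then show "sqnorm (x - minimizer G) \<le> 2 / \<mu> * potential x v"
    using mu_pos by (simp add: field_simps)
  have "\<mu> / 2 * sqnorm (v - minimizer G) \<le> potential x v"
    using minimizer_le[of x] by (simp add: potential_def)
  then show "sqnorm (v - minimizer G) \<le> 2 / \<mu> * potential x v"
    using mu_pos by (simp add: field_simps)
qed

text \<open>
  Expanding the square of \<open>vn - x*\<close> produces the term \<open>+ sqnorm (grad y) / (2 L)\<close>, which the decrease of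
  \<open>G\<close> cancels, and a term linear in \<open>grad y\<close>, which is split so that the convexity bounds at \<open>y\<close>
  against \<open>x\<close> and against the minimizer apply with weights \<open>1 - \<theta>\<close> and \<open>\<theta>\<close>.
\<close>

lemma potential_step:
  assumes L: "L > 0" and \<theta>: "0 < \<theta>" "\<theta> < 1" "L * \<theta>\<^sup>2 = \<mu>"
    and y: "(1 + \<theta>) *\<^sub>R y = x + \<theta> *\<^sub>R v"
    and decrease: "G (y - (1 / L) *\<^sub>R grad y) \<le> G y - sqnorm (grad y) / (2 * L)"
    and xn: "xn = y - (1 / L) *\<^sub>R grad y"
    and vn: "vn = x + (1 / \<theta>) *\<^sub>R (xn - x)"
  shows "potential xn vn \<le> (1 - \<theta>) * potential x v"
proof -
  let ?m = "minimizer G" and ?g = "grad y"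
  define w where "w = (1 - \<theta>) *\<^sub>R (v - ?m) + \<theta> *\<^sub>R (y - ?m)"
  have x: "x = y + \<theta> *\<^sub>R y - \<theta> *\<^sub>R v" using y by (simp add: algebra_simps)
  have vn_eq: "vn - ?m = w - (1 / (L * \<theta>)) *\<^sub>R ?g"
  proof -
    have "xn - x = \<theta> *\<^sub>R (v - y) - (1 / L) *\<^sub>R ?g" unfolding xn x by (simp add: algebra_simps)
    then have "(1 / \<theta>) *\<^sub>R (xn - x) = (v - y) - (1 / (L * \<theta>)) *\<^sub>R ?g"
      using \<theta>(1) by (simp add: scaleR_right_diff_distrib mult.commute)
    then show ?thesis unfolding vn w_def by (simp add: x algebra_simps)
  qed
  have w_grad: "\<theta> * \<L> ?g w = (1 - \<theta>) * \<L> ?g (y - x) + \<theta> * \<L> ?g (y - ?m)"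
    unfolding w_def x by (simp add: blinfun.bilinear_simps algebra_simps)
  have "\<mu> / 2 * sqnorm (vn - ?m)
      = \<mu> / 2 * sqnorm w - \<mu> / (L * \<theta>) * \<L> w ?g + \<mu> / 2 * (1 / (L * \<theta>))\<^sup>2 * sqnorm ?g"
    unfolding vn_eq sqnorm_diff sqnorm_scaleR[of _ ?g] blinfun.scaleR_right[of "\<L> w"] real_scaleR_def
    by (simp add: algebra_simps)
  also have "\<dots> = \<mu> / 2 * sqnorm w - \<theta> * \<L> ?g w + sqnorm ?g / (2 * L)"
    unfolding sym[of w ?g] \<theta>(3)[symmetric] using L \<theta>(1) by (simp add: field_simps power2_eq_square)
  finally have vn_sq: "\<mu> / 2 * sqnorm (vn - ?m)
      = \<mu> / 2 * sqnorm w - \<theta> * \<L> ?g w + sqnorm ?g / (2 * L)" .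
  have "\<mu> / 2 * sqnorm w \<le> \<mu> / 2 * ((1 - \<theta>) * sqnorm (v - ?m) + \<theta> * sqnorm (y - ?m))"
    unfolding w_def using sqnorm_convex[of \<theta> "v - ?m" "y - ?m"] \<theta> mu_pos
    by (intro mult_left_mono) auto
  moreover have "(1 - \<theta>) * (G y - G x) \<le> (1 - \<theta>) * \<L> ?g (y - x)"
  proof (rule mult_left_mono)
    have "0 \<le> \<mu> / 2 * sqnorm (y - x)" using mu_pos sqnorm_ge_0[of "y - x"] by simp
    then show "G y - G x \<le> \<L> ?g (y - x)" using grad_lower_bound[of y x] by linarith
  qed (use \<theta> in simp)
  moreover have "\<theta> * (G y - G ?m + \<mu> / 2 * sqnorm (y - ?m)) \<le> \<theta> * \<L> ?g (y - ?m)"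
    using \<theta> grad_lower_bound[of y ?m] by (intro mult_left_mono) auto
  ultimately have "G xn - G ?m + \<mu> / 2 * sqnorm (vn - ?m)
      \<le> G y - G ?m + \<mu> / 2 * ((1 - \<theta>) * sqnorm (v - ?m) + \<theta> * sqnorm (y - ?m))
        - (1 - \<theta>) * (G y - G x) - \<theta> * (G y - G ?m + \<mu> / 2 * sqnorm (y - ?m))"
    using decrease vn_sq w_grad unfolding xn by linarith
  also have "\<dots> = (1 - \<theta>) * (G x - G ?m + \<mu> / 2 * sqnorm (v - ?m))"
    by (simp add: field_simps)
  finally show ?thesis by (simp add: potential_def)
qed

end

section \<open>The iteration\<close>

lemma pagd_x_0: "pagd_x \<L> G' \<eta> s x0 0 = x0"
  by (simp add: pagd_x_def)

lemma pagd_x_Suc: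
  "pagd_x \<L> G' \<eta> s x0 (Suc k) =
    pagd_y \<L> G' \<eta> s x0 k - s *\<^sub>R inv \<L> (G' (pagd_y \<L> G' \<eta> s x0 k))"
  by (simp add: pagd_x_def pagd_y_def Let_def split: prod.split)

lemma pagd_y_0: "pagd_y \<L> G' \<eta> s x0 0 = x0"
  by (simp add: pagd_y_def pagd_extrapolate_def)

lemma pagd_y_Suc:
  "pagd_y \<L> G' \<eta> s x0 (Suc k) =
    pagd_extrapolate \<eta> s (pagd_x \<L> G' \<eta> s x0 k) (pagd_x \<L> G' \<eta> s x0 (Suc k))"
  by (simp add: pagd_x_def pagd_y_def Let_def split: prod.split)

text \<open>
  The extrapolated point is the convex combination of \<open>x\<^sub>k\<close> and \<open>v\<^sub>k\<close> with weights in the ratio \<open>1 : \<theta>\<close>. At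
  \<open>k = 0\<close> the three points coincide, because \<open>x\<^bsub>-1\<^esub> = x\<^sub>0\<close>.
\<close>

lemma pagd_y_between:
  fixes \<L> :: "'a::{real_inner, polish_space} \<Rightarrow> ('a \<Rightarrow>\<^sub>L real)"
  assumes \<theta>: "\<theta> = pagd_theta \<eta> s" "0 < \<theta>"
  shows "(1 + \<theta>) *\<^sub>R pagd_y \<L> G' \<eta> s x0 k =
    pagd_x \<L> G' \<eta> s x0 k + \<theta> *\<^sub>R pagd_v \<L> G' \<eta> s x0 k"
proof (cases k)
  case 0
  then show ?thesis by (simp add: pagd_x_0 pagd_y_0 scaleR_left_distrib)
next
  case (Suc j)
  let ?x = "pagd_x \<L> G' \<eta> s x0"
  have "(1 + \<theta>) * pagd_lambda \<eta> s = 1 - \<theta>"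
    using \<theta> by (simp add: pagd_lambda_def)
  then have "(1 + \<theta>) *\<^sub>R pagd_y \<L> G' \<eta> s x0 k
      = (1 + \<theta>) *\<^sub>R ?x (Suc j) + (1 - \<theta>) *\<^sub>R (?x (Suc j) - ?x j)"
    by (simp add: Suc pagd_y_Suc pagd_extrapolate_def scaleR_right_distrib)
  also have "\<dots> = ?x (Suc j) + \<theta> *\<^sub>R ?x j + (?x (Suc j) - ?x j)"
    by (simp add: algebra_simps)
  also have "\<dots> = ?x k + \<theta> *\<^sub>R pagd_v \<L> G' \<eta> s x0 k"
    using \<theta> by (simp add: Suc scaleR_right_distrib)
  finally show ?thesis .
qed

context strongly_convex_function
begin

text \<open>
  The number \<open>c\<close> is the squared radius of a ball on which \<open>G\<close> is smooth. The second alternative of the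
  hypothesis \<open>c\<close> is the case in which \<open>x0\<close> is the minimizer.
\<close>

lemma pagd_convergence:
  fixes x0 :: 'a and k :: nat
  assumes L: "L > 0" "\<mu> < L"
    and smooth: "\<And>x y. sqnorm (x - minimizer G) \<le> c \<Longrightarrow> sqnorm (y - minimizer G) \<le> c \<Longrightarrow>
      (G' x - G' y) (x - y) \<le> L * sqnorm (x - y)"
    and c: "2 / \<mu> * potential x0 x0 < c \<or> potential x0 x0 = 0"
  defines "x \<equiv> pagd_x \<L> G' (sqrt \<mu>) (1 / L) x0"
    and "y \<equiv> pagd_y \<L> G' (sqrt \<mu>) (1 / L) x0"
    and "v \<equiv> pagd_v \<L> G' (sqrt \<mu>) (1 / L) x0"
  shows "potential (x k) (v k) \<le> (1 - sqrt (\<mu> / L)) ^ k * potential x0 x0"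
    and "sqnorm (grad (y k)) \<le> 4 * L\<^sup>2 * (2 / \<mu> * ((1 - sqrt (\<mu> / L)) ^ k * potential x0 x0))"
proof -
  let ?m = "minimizer G"
  define \<theta> where "\<theta> = sqrt (\<mu> / L)"
  have \<theta>_eq: "\<theta> = pagd_theta (sqrt \<mu>) (1 / L)"
    by (simp add: \<theta>_def pagd_theta_def real_sqrt_divide)
  have \<theta>: "0 < \<theta>" "\<theta> < 1" "L * \<theta>\<^sup>2 = \<mu>"
    using L mu_pos by (simp_all add: \<theta>_def)
  define P where "P k = potential (x k) (v k)" for k
  have P0: "P 0 = potential x0 x0" by (simp add: P_def x_def v_def pagd_x_0)
  have P_ge_0: "0 \<le> P k" for k by (simp add: P_def potential_ge_0)
  have y_eq: "(1 + \<theta>) *\<^sub>R y k = x k + \<theta> *\<^sub>R v k" for k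
    unfolding x_def y_def v_def by (rule pagd_y_between[OF \<theta>_eq \<theta>(1)])
  have y_dist: "sqnorm (y k - ?m) \<le> 2 / \<mu> * P k" for k
  proof -
    define t where "t = \<theta> / (1 + \<theta>)"
    have t: "0 \<le> t" "t \<le> 1" and t1: "1 - t = 1 / (1 + \<theta>)"
      using \<theta> by (auto simp: t_def field_simps)
    have "y k = (1 / (1 + \<theta>)) *\<^sub>R ((1 + \<theta>) *\<^sub>R y k)" using \<theta> by simp
    also have "\<dots> = (1 - t) *\<^sub>R x k + t *\<^sub>R v k"
      unfolding y_eq t1 by (simp add: t_def scaleR_right_distrib)
    finally have "y k - ?m = (1 - t) *\<^sub>R (x k - ?m) + t *\<^sub>R (v k - ?m)"
      by (simp add: algebra_simps)
    then show ?thesis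
      using sqnorm_convex_le[OF t sqnorm_le_potential[where x = "x k" and v = "v k"]]
      by (simp add: P_def)
  qed
  have step: "sqnorm (y k - ?m) < c \<or> y k = ?m" if "P k \<le> P 0" for k
  proof -
    have le: "sqnorm (y k - ?m) \<le> 2 / \<mu> * P 0"
      using y_dist[of k] mult_left_mono[OF that, of "2 / \<mu>"] mu_pos by simp
    show ?thesis
    proof (cases "P 0 = 0")
      case True
      with le have "sqnorm (y k - ?m) = 0" using sqnorm_ge_0[of "y k - ?m"] by simp
      then show ?thesis by (simp add: sqnorm_eq_0_iff)
    next
      case False
      with c le show ?thesis by (simp add: P0)
    qed
  qed
  have x_Suc: "x (Suc k) = y k - (1 / L) *\<^sub>R grad (y k)" for k
    by (simp add: x_def y_def pagd_x_Suc)
  have v_Suc: "v (Suc k) = x k + (1 / \<theta>) *\<^sub>R (x (Suc k) - x k)" for k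
    by (simp add: x_def v_def \<theta>_eq)
  \<comment> \<open>monotonicity keeps \<open>y k\<close> inside the ball and has to be carried through the induction\<close>
  have decay: "P k \<le> (1 - \<theta>) ^ k * P 0 \<and> P k \<le> P 0" for k
  proof (induction k)
    case (Suc k)
    have "P (Suc k) \<le> (1 - \<theta>) * P k"
      unfolding P_def
      by (rule potential_step[OF L(1) \<theta> y_eq gradient_step(1)[where c = c, OF L(1) smooth step] x_Suc v_Suc])
        (use Suc in auto)
    moreover have "(1 - \<theta>) * P k \<le> (1 - \<theta>) * ((1 - \<theta>) ^ k * P 0)"
      using Suc \<theta> by (intro mult_left_mono) auto
    moreover have "(1 - \<theta>) * P k \<le> P k"
      using \<theta> P_ge_0[of k] by (simp add: mult_le_cancel_right2)
    ultimately show ?case using Suc by auto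
  qed simp
  then show "potential (x k) (v k) \<le> (1 - sqrt (\<mu> / L)) ^ k * potential x0 x0"
    by (simp add: P_def[symmetric] P0[symmetric] \<theta>_def[symmetric])
  have "sqnorm (x (Suc k) - ?m) \<le> sqnorm (y k - ?m)"
    unfolding x_Suc by (rule gradient_step(2)[where c = c, OF L(1) smooth step]) (use decay in auto)
  moreover have "(1 / L) *\<^sub>R grad (y k) = (y k - ?m) - (x (Suc k) - ?m)" by (simp add: x_Suc)
  then have "(1 / L)\<^sup>2 * sqnorm (grad (y k)) = sqnorm ((y k - ?m) - (x (Suc k) - ?m))"
    by (metis sqnorm_scaleR)
  ultimately have "(1 / L)\<^sup>2 * sqnorm (grad (y k)) \<le> 4 * (2 / \<mu> * P k)"
    using sqnorm_diff_le[of "y k - ?m" "x (Suc k) - ?m"] y_dist[of k] by linarith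
  also have "\<dots> \<le> 4 * (2 / \<mu> * ((1 - \<theta>) ^ k * P 0))"
    using decay[of k] mu_pos by (intro mult_left_mono) auto
  finally have "L\<^sup>2 * ((1 / L)\<^sup>2 * sqnorm (grad (y k)))
      \<le> L\<^sup>2 * (4 * (2 / \<mu> * ((1 - \<theta>) ^ k * P 0)))"
    by (rule mult_left_mono) simp
  then show "sqnorm (grad (y k)) \<le> 4 * L\<^sup>2 * (2 / \<mu> * ((1 - sqrt (\<mu> / L)) ^ k * potential x0 x0))"
    using L(1) unfolding P0 \<theta>_def by (simp add: power_divide mult_ac)
qed

end

lemma step_size_condition_imp_less:
  assumes "\<mu> > 0" "L > 0" "r > 1" "step_size_condition \<mu> r L (1 / L)"
  shows "\<mu> < L"
proof -
  have "((r - 1) / (r + 1))\<^sup>2 < 1"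
    using power_strict_mono[of "(r - 1) / (r + 1)" 1 2] assms(3) by simp
  then have "((r - 1) / (r + 1))\<^sup>2 * (1 / \<mu>) < 1 / \<mu>"
    using assms(1) by (simp add: divide_strict_right_mono)
  moreover have "1 / L \<le> ((r - 1) / (r + 1))\<^sup>2 * (1 / \<mu>)"
    using assms(4) by (simp add: step_size_condition_def)
  ultimately have "1 / L < 1 / \<mu>" by linarith
  then show ?thesis using assms(1,2) by (simp add: field_simps)
qed

lemma sqrt_power_eq_powr:
  assumes "0 < q"
  shows "sqrt (q ^ k) = q powr (real k / 2)"
  using assms by (simp add: powr_half_sqrt[symmetric] powr_realpow[symmetric] powr_powr)

theorem corollary5p9:
  fixes \<L> :: "'a::{real_inner, polish_space} \<Rightarrow> ('a \<Rightarrow>\<^sub>L real)"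
    and G :: "'a \<Rightarrow> real"
    and G' :: "'a \<Rightarrow> ('a \<Rightarrow>\<^sub>L real)"
    and \<mu> \<eta> :: real
    and x0 :: 'a
  assumes "preconditioner \<L>"
    and "\<And>x. (G has_derivative blinfun_apply (G' x)) (at x)"
    and "locally_lipschitz_smooth \<L> G'"
    and "strongly_convex \<L> G' \<mu>"
    and "\<eta> = sqrt \<mu>"
  shows "(\<exists>r>1. \<exists>L. smoothness_constant \<L> G' (pagd_ball \<L> G \<mu> x0 r) L \<and>
            step_size_condition \<mu> r L (1 / L)) \<and>
    (\<forall>r>1. \<forall>L. smoothness_constant \<L> G' (pagd_ball \<L> G \<mu> x0 r) L \<and>
       step_size_condition \<mu> r L (1 / L) \<longrightarrow>
       (let x = pagd_x \<L> G' \<eta> (1 / L) x0;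
            y = pagd_y \<L> G' \<eta> (1 / L) x0;
            v = pagd_v \<L> G' \<eta> (1 / L) x0;
            \<rho> = \<mu> / L;
            E0 = pagd_energy \<L> G \<eta> x0 x0
        in \<forall>k::nat.
             pagd_energy \<L> G \<eta> (x k) (v k) \<le> (1 - sqrt \<rho>) ^ k * E0 \<and>
             G (x k) - G (minimizer G) \<le> (1 - sqrt \<rho>) ^ k * (\<eta> * E0) \<and>
             precond_norm \<L> (x k - minimizer G)
               \<le> (1 - sqrt \<rho>) powr (real k / 2) * sqrt (2 * E0 / \<eta>) \<and>
             precond_dual_norm \<L> (G' (y k))
               \<le> 3 * L * sqrt (2 * E0 / \<eta>) * (1 - sqrt \<rho>) powr ((real k - 1) / 2)))"
proof -
  interpret strongly_convex_function \<L> G G' \<mu>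
    using assms(1,2,4) by unfold_locales
  let ?m = "minimizer G"
  have "\<exists>r>1. \<exists>L. smoothness_constant \<L> G' (pagd_ball \<L> G \<mu> x0 r) L \<and>
      step_size_condition \<mu> r L (1 / L)"
  proof -
    have "bounded (pagd_ball \<L> G \<mu> x0 2)" "convex (pagd_ball \<L> G \<mu> x0 2)"
      by (simp_all add: pagd_ball_def bounded_energy_ball convex_energy_ball)
    then obtain L0 where L0: "smoothness_constant \<L> G' (pagd_ball \<L> G \<mu> x0 2) L0"
      using assms(3) unfolding locally_lipschitz_smooth_def by blast
    \<comment> \<open>\<open>r = 2\<close> gives \<open>((r - 1) / (r + 1))\<^sup>2 = 1/9\<close>; smoothness constants may be enlarged\<close>
    define L where "L = max L0 (9 * \<mu>)"
    have L: "L > 0" "L0 \<le> L" "9 * \<mu> \<le> L" using mu_pos by (auto simp: L_def)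
    have "smoothness_constant \<L> G' (pagd_ball \<L> G \<mu> x0 2) L"
      using L0 L unfolding smoothness_constant_def
      by (meson mult_right_mono order_trans zero_le_power2)
    moreover have "step_size_condition \<mu> 2 L (1 / L)"
      using L mu_pos by (simp add: step_size_condition_def field_simps power2_eq_square)
    ultimately show ?thesis by (intro exI[of _ 2]) auto
  qed
  moreover have "pagd_energy \<L> G \<eta> (pagd_x \<L> G' \<eta> (1 / L) x0 k) (pagd_v \<L> G' \<eta> (1 / L) x0 k)
        \<le> (1 - sqrt (\<mu> / L)) ^ k * pagd_energy \<L> G \<eta> x0 x0 \<and>
      G (pagd_x \<L> G' \<eta> (1 / L) x0 k) - G ?m
        \<le> (1 - sqrt (\<mu> / L)) ^ k * (\<eta> * pagd_energy \<L> G \<eta> x0 x0) \<and>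
      precond_norm \<L> (pagd_x \<L> G' \<eta> (1 / L) x0 k - ?m)
        \<le> (1 - sqrt (\<mu> / L)) powr (real k / 2) * sqrt (2 * pagd_energy \<L> G \<eta> x0 x0 / \<eta>) \<and>
      precond_dual_norm \<L> (G' (pagd_y \<L> G' \<eta> (1 / L) x0 k))
        \<le> 3 * L * sqrt (2 * pagd_energy \<L> G \<eta> x0 x0 / \<eta>)
          * (1 - sqrt (\<mu> / L)) powr ((real k - 1) / 2)"
    if r: "r > 1" and sm: "smoothness_constant \<L> G' (pagd_ball \<L> G \<mu> x0 r) L"
      and ss: "step_size_condition \<mu> r L (1 / L)" for r L k
  proof -
    have L: "L > 0" using sm by (simp add: smoothness_constant_def)
    have \<mu>L: "\<mu> < L" by (rule step_size_condition_imp_less[OF mu_pos L r ss])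
    define q where "q = 1 - sqrt (\<mu> / L)"
    have q: "0 < q" "q \<le> 1" using \<mu>L L mu_pos by (simp_all add: q_def)
    define x where "x = pagd_x \<L> G' (sqrt \<mu>) (1 / L) x0"
    define y where "y = pagd_y \<L> G' (sqrt \<mu>) (1 / L) x0"
    define v where "v = pagd_v \<L> G' (sqrt \<mu>) (1 / L) x0"
    define D where "D = G x0 - G ?m"
    define R where "R = pagd_radius G \<mu> x0 r"
    have D: "0 \<le> D" using minimizer_le by (simp add: D_def)
    have R: "R = sqrt (2 / \<mu> * D) + sqrt (2 * r * D / \<mu>)"
      by (simp add: R_def pagd_radius_def D_def real_sqrt_divide)
    have R0: "0 \<le> R" unfolding R using D mu_pos r by simp
    have smooth: "(G' x - G' y) (x - y) \<le> L * sqnorm (x - y)"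
      if "sqnorm (x - ?m) \<le> R\<^sup>2" "sqnorm (y - ?m) \<le> R\<^sup>2" for x y
      using sm that precond_norm_le_iff[OF R0]
      by (simp add: smoothness_constant_def pagd_ball_def R_def[symmetric] precond_norm_power2)
    have init: "2 / \<mu> * potential x0 x0 < R\<^sup>2 \<or> potential x0 x0 = 0"
    proof -
      have P: "potential x0 x0 \<le> 2 * D"
        using sqnorm_le_gap[of x0] by (simp add: potential_def D_def)
      show ?thesis
      proof (cases "D = 0")
        case True
        with P potential_ge_0[of x0 x0] show ?thesis by simp
      next
        case False
        with D have "D > 0" by simp
        have "2 / \<mu> * potential x0 x0 \<le> 2 / \<mu> * (2 * D)"
          using P mu_pos by (intro mult_left_mono) auto
        \<comment> \<open>\<open>r > 1\<close> makes the ball of radius \<open>R\<close> strictly larger than the region that the potential allows\<close>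
        also have "\<dots> < 2 / \<mu> * D + 2 * r * D / \<mu>"
          using r \<open>D > 0\<close> mu_pos by (simp add: field_simps)
        also have "\<dots> = (sqrt (2 / \<mu> * D))\<^sup>2 + (sqrt (2 * r * D / \<mu>))\<^sup>2"
          using r D mu_pos by simp
        also have "\<dots> \<le> R\<^sup>2"
          unfolding R power2_sum using r D mu_pos by simp
        finally show ?thesis by simp
      qed
    qed
    note conv = pagd_convergence[where c = "R\<^sup>2", OF L \<mu>L smooth init, of k,
        folded x_def y_def v_def q_def]
    define P0 where "P0 = potential x0 x0"
    have E0: "pagd_energy \<L> G (sqrt \<mu>) x0 x0 = P0 / sqrt \<mu>"
      by (simp add: P0_def pagd_energy_eq)
    have P0: "0 \<le> P0" by (simp add: P0_def potential_ge_0)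
    have E0': "2 * (P0 / sqrt \<mu>) / sqrt \<mu> = 2 / \<mu> * P0"
      using mu_pos by (simp add: field_simps)
    have "pagd_energy \<L> G (sqrt \<mu>) (x k) (v k) \<le> q ^ k * (P0 / sqrt \<mu>)"
      using conv(1) mu_pos by (simp add: pagd_energy_eq P0_def divide_right_mono)
    moreover have "G (x k) - G ?m \<le> q ^ k * (sqrt \<mu> * (P0 / sqrt \<mu>))"
      using gap_le_potential[of "x k" "v k"] conv(1) mu_pos by (simp add: P0_def)
    moreover have "precond_norm \<L> (x k - ?m) \<le> q powr (real k / 2) * sqrt (2 / \<mu> * P0)"
    proof -
      have "sqnorm (x k - ?m) \<le> 2 / \<mu> * (q ^ k * P0)"
        using sqnorm_le_potential(1)[of "x k" "v k"] mult_left_mono[OF conv(1), of "2 / \<mu>"] mu_pos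
        by (simp add: P0_def)
      also have "\<dots> = q ^ k * (2 / \<mu> * P0)" by simp
      finally show ?thesis
        unfolding precond_norm_def sqrt_power_eq_powr[OF q(1), symmetric]
        by (simp only: real_sqrt_mult[symmetric] real_sqrt_le_iff)
    qed
    moreover have "precond_dual_norm \<L> (G' (y k))
        \<le> 3 * L * sqrt (2 / \<mu> * P0) * q powr ((real k - 1) / 2)"
    proof -
      have "precond_dual_norm \<L> (G' (y k)) \<le> sqrt ((2 * L)\<^sup>2 * (2 / \<mu> * P0) * q ^ k)"
        unfolding precond_dual_norm_eq precond_norm_def real_sqrt_le_iff
        using conv(2) by (simp add: P0_def power2_eq_square mult_ac)
      also have "\<dots> = sqrt ((2 * L)\<^sup>2) * sqrt (2 / \<mu> * P0) * q powr (real k / 2)"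
        by (simp only: real_sqrt_mult[of _ "q ^ k"] real_sqrt_mult[of "(2 * L)\<^sup>2"]
            sqrt_power_eq_powr[OF q(1)])
      also have "sqrt ((2 * L)\<^sup>2) = 2 * L"
        using L by (intro real_sqrt_unique) auto
      also have "2 * L * sqrt (2 / \<mu> * P0) * q powr (real k / 2)
          \<le> 3 * L * sqrt (2 / \<mu> * P0) * q powr ((real k - 1) / 2)"
      proof (rule mult_mono)
        show "q powr (real k / 2) \<le> q powr ((real k - 1) / 2)"
          using q by (intro powr_mono') auto
        show "2 * L * sqrt (2 / \<mu> * P0) \<le> 3 * L * sqrt (2 / \<mu> * P0)"
          using L P0 mu_pos by (intro mult_right_mono) auto
      qed (use L P0 mu_pos in auto)
      finally show ?thesis .
    qed
    ultimately show ?thesis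
      unfolding assms(5) E0 E0' x_def y_def v_def q_def by blast
  qed
  ultimately show ?thesis by (auto simp: Let_def)
qed

end
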